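(* Let $G=(V,E)$ be a simple graph with $n=|V|$ vertices. Then: (1) $\bar{\gamma}_p(G)=n-1$ if and only if $G$ has an isolated vertex. (2) $\bar{\gamma}_p(G)=n-2$ if and only if $G$ has a connected component isomorphic to $K_2$ and has no isolated vertices. (3) $\bar{\gamma}_p(G)=n-3$ if and only if $G$ has no connected component that is an isolated vertex or $K_2$, and $G$ contains as an induced subgraph either a path $P_3$ in which only the middle vertex may be adjacent to other vertices of $V$, or a triangle $K_3$ in which at most one of the three vertices may be adjacent to other vertices of $V$.
   Context: For $v\in V$, $N[v]$ is the closed neighborhood; for $S\subseteq V$, $N[S]=\bigcup_{v\in S}N[v]$. Define $\mathcal{P}^0(S)=N[S]$, $\mathcal{P}^{i+1}(S)=\mathcal{P}^i(S)\cup\{w : \{w\}=N[v]\setminus\mathcal{P}^i(S)\text{ for some } v\in\mathcal{P}^i(S)\}$, with eventual value $\mathcal{P}^\infty(S)$. $S$ is a power dominating set (PDS) if $\mathcal{P}^\infty(S)=V$, and a failed power dominating set (FPDS) otherwise. The failed power domination number $\bar{\gamma}_p(G)$ is the maximum cardinality of an FPDS of $G$. *)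

theory Defs
  imports "Graph_Theory.Graph_Theory"
begin

text \<open>
  Finite simple graphs are the locale \<^locale>\<open>graph\<close>: finite, symmetric, loop-free digraphs
  without parallel arcs. An edge is a pair of opposite arcs, so the connected components are the
  strongly connected components \<^const>\<open>pre_digraph.sccs\<close>.
\<close>

definition closed_nbhd :: "('a, 'b) pre_digraph \<Rightarrow> 'a \<Rightarrow> 'a set" where
  "closed_nbhd G v = insert v {w. v \<rightarrow>\<^bsub>G\<^esub> w}"

primrec observed :: "('a, 'b) pre_digraph \<Rightarrow> 'a set \<Rightarrow> nat \<Rightarrow> 'a set" where
  "observed G S 0 = (\<Union>v\<in>S. closed_nbhd G v)"
| "observed G S (Suc i) =
     observed G S i \<union> {w. \<exists>v \<in> observed G S i. closed_nbhd G v - observed G S i = {w}}"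

text \<open>
  The sets \<^term>\<open>observed G S i\<close> increase with \<^term>\<open>i\<close>, so their union is their eventual value;
  see \<open>observed_eventually\<close>.
\<close>

definition observed_lim :: "('a, 'b) pre_digraph \<Rightarrow> 'a set \<Rightarrow> 'a set" where
  "observed_lim G S = (\<Union>i. observed G S i)"

definition power_dominating :: "('a, 'b) pre_digraph \<Rightarrow> 'a set \<Rightarrow> bool" where
  "power_dominating G S \<longleftrightarrow> S \<subseteq> verts G \<and> observed_lim G S = verts G"

definition failed_power_dominating :: "('a, 'b) pre_digraph \<Rightarrow> 'a set \<Rightarrow> bool" where
  "failed_power_dominating G S \<longleftrightarrow> S \<subseteq> verts G \<and> \<not> power_dominating G S"

text \<open>
  If \<^term>\<open>G\<close> is finite and has a vertex, then the empty set is a failed power dominating set and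
  the maximum below exists. For the null graph the value is unspecified.
\<close>

definition failed_power_domination_number :: "('a, 'b) pre_digraph \<Rightarrow> nat" where
  "failed_power_domination_number G = Max (card ` {S. failed_power_dominating G S})"

definition isolated_vertex :: "('a, 'b) pre_digraph \<Rightarrow> 'a \<Rightarrow> bool" where
  "isolated_vertex G v \<longleftrightarrow> v \<in> verts G \<and> (\<forall>w. \<not> v \<rightarrow>\<^bsub>G\<^esub> w)"

definition path_graph :: "'a list \<Rightarrow> ('a, 'b) pre_digraph \<Rightarrow> bool" where
  "path_graph xs H \<longleftrightarrow> graph H \<and> distinct xs \<and> verts H = set xs \<and>
     arcs_ends H = {(xs ! i, xs ! j) | i j.
       i < length xs \<and> j < length xs \<and> (j = Suc i \<or> i = Suc j)}"

definition boundary_verts :: "('a, 'b) pre_digraph \<Rightarrow> ('a, 'b) pre_digraph \<Rightarrow> 'a set" where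
  "boundary_verts G H = {u \<in> verts H. \<exists>w \<in> verts G - verts H. u \<rightarrow>\<^bsub>G\<^esub> w}"

lemma observed_mono: "i \<le> j \<Longrightarrow> observed G S i \<subseteq> observed G S j"
  by (rule lift_Suc_mono_le) auto

lemma (in wf_digraph) observed_subset_verts:
  assumes "S \<subseteq> verts G"
  shows "observed G S i \<subseteq> verts G"
proof (induction i)
  case 0
  show ?case using assms adj_in_verts(2) by (auto simp: closed_nbhd_def)
next
  case (Suc i)
  have "w \<in> verts G"
    if v: "v \<in> observed G S i" and w: "closed_nbhd G v - observed G S i = {w}" for v w
  proof -
    have "w \<in> closed_nbhd G v" using w by blast
    then have "w = v \<or> v \<rightarrow> w" unfolding closed_nbhd_def by simp
    then show ?thesis using v Suc adj_in_verts(2) by blast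
  qed
  then show ?case unfolding observed.simps using Suc by blast
qed

lemma (in fin_digraph) observed_eventually:
  assumes "S \<subseteq> verts G"
  shows "\<forall>\<^sub>F i in sequentially. observed G S i = observed_lim G S"
proof -
  have "observed_lim G S \<subseteq> verts G"
    unfolding observed_lim_def using observed_subset_verts[OF assms] by (rule UN_least)
  then have fin: "finite (observed_lim G S)" by (rule finite_subset) simp
  have "\<forall>\<^sub>F i in sequentially. x \<in> observed G S i" if x: "x \<in> observed_lim G S" for x
  proof -
    from x obtain k where k: "x \<in> observed G S k" unfolding observed_lim_def by blast
    show ?thesis
    proof (rule eventually_sequentiallyI)
      show "x \<in> observed G S i" if "k \<le> i" for i
        using observed_mono[OF that] k by (rule subsetD)
    qed
  qed
  then have "\<forall>\<^sub>F i in sequentially. \<forall>x \<in> observed_lim G S. x \<in> observed G S i"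
    using fin by (simp add: eventually_ball_finite)
  then show ?thesis
  proof (rule eventually_mono)
    show "observed G S i = observed_lim G S"
      if "\<forall>x \<in> observed_lim G S. x \<in> observed G S i" for i
      using that unfolding observed_lim_def by blast
  qed
qed

end

(*
  Call a nonempty vertex set U a fort if no vertex outside U has exactly one neighbour in U.
  The complement of the eventual value of a failed power dominating set S is a fort whose closed
  neighbourhood misses S, and conversely no vertex of a fort U is ever observed from a set that
  misses N[U]. Hence the failed power domination number is n minus the minimum of |N[U]| over
  all forts U, and it remains to classify the forts with |N[U]| \<le> 3.
*)
theory Submission
  imports Defs
begin

definition closed_nbhd_set :: "('a, 'b) pre_digraph \<Rightarrow> 'a set \<Rightarrow> 'a set" where
  "closed_nbhd_set G U = (\<Union>u\<in>U. closed_nbhd G u)"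

definition fort :: "('a, 'b) pre_digraph \<Rightarrow> 'a set \<Rightarrow> bool" where
  "fort G U \<longleftrightarrow> U \<noteq> {} \<and> U \<subseteq> verts G \<and>
     (\<forall>v \<in> verts G - U. \<forall>w. closed_nbhd G v \<inter> U \<noteq> {w})"

section \<open>Adjacency in induced subgraphs and in simple graphs\<close>

lemma arcs_ends_induced:
  assumes "induced_subgraph H G"
  shows "u \<rightarrow>\<^bsub>H\<^esub> v \<longleftrightarrow> u \<rightarrow>\<^bsub>G\<^esub> v \<and> u \<in> verts H \<and> v \<in> verts H"
proof -
  have "compatible G H" using assms by auto
  then show ?thesis
    using assms by (auto simp: induced_subgraph_def arcs_ends_conv compatible_tail compatible_head)
qed

context graph
begin

lemma adj_sym: "u \<rightarrow> v \<longleftrightarrow> v \<rightarrow> u"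
  using arcs_ends_symmetric[OF sym_arcs] by blast

lemma adj_irrefl [simp]: "\<not> u \<rightarrow> u"
  using adj_not_same by blast

text \<open>Both \<open>path_graph\<close> and \<open>complete_digraph\<close> demand a
  \<open>graph\<close>; this discharges that clause for the subgraphs constructed later.\<close>

lemma graph_induced:
  assumes "induced_subgraph H G"
  shows "graph H"
proof -
  interpret H: digraph H using assms by (rule digraphI_induced)
  show ?thesis using induced_graph_imp_symmetric[OF sym_arcs assms] by (rule H.graphI)
qed

section \<open>Forts\<close>

lemma closed_nbhd_sym: "u \<in> closed_nbhd G v \<longleftrightarrow> v \<in> closed_nbhd G u"
  using adj_sym by (auto simp: closed_nbhd_def)

lemma closed_nbhd_subset_verts: "v \<in> verts G \<Longrightarrow> closed_nbhd G v \<subseteq> verts G"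
  using adj_in_verts(2) by (auto simp: closed_nbhd_def)

lemma closed_nbhd_set_subset_verts: "U \<subseteq> verts G \<Longrightarrow> closed_nbhd_set G U \<subseteq> verts G"
  using closed_nbhd_subset_verts unfolding closed_nbhd_set_def by blast

lemma subset_closed_nbhd_set: "U \<subseteq> closed_nbhd_set G U"
  by (auto simp: closed_nbhd_set_def closed_nbhd_def)

text \<open>Induction on the stage. While \<open>U\<close> is unobserved, every observed
  \<open>v\<close> lies outside \<open>U\<close>, and forcing some \<open>w\<close> in
  \<open>U\<close> would make \<open>w\<close> its only neighbour there, which a fort forbids. Stage
  0 uses the symmetry of closed neighbourhoods.\<close>

lemma fort_unobserved:
  assumes "fort G U" "S \<subseteq> verts G" "S \<inter> closed_nbhd_set G U = {}"
  shows "observed G S i \<inter> U = {}"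
proof (induction i)
  case 0
  show ?case using assms(3) closed_nbhd_sym by (auto simp: closed_nbhd_set_def)
next
  case (Suc i)
  have "w \<notin> U" if v: "v \<in> observed G S i" and w: "closed_nbhd G v - observed G S i = {w}" for v w
  proof
    assume "w \<in> U"
    then have "closed_nbhd G v \<inter> U = {w}" using w Suc by blast
    moreover have "v \<in> verts G - U" using v Suc observed_subset_verts[OF assms(2)] by blast
    ultimately show False using assms(1) unfolding fort_def by blast
  qed
  then show ?case using Suc by auto
qed

lemma fort_imp_failed_power_dominating:
  assumes "fort G U"
  shows "failed_power_dominating G (verts G - closed_nbhd_set G U)"
proof -
  have "observed_lim G (verts G - closed_nbhd_set G U) \<inter> U = {}"
    using fort_unobserved[OF assms, of "verts G - closed_nbhd_set G U"]
    unfolding observed_lim_def by blast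
  then show ?thesis
    using assms unfolding failed_power_dominating_def power_dominating_def fort_def by blast
qed

text \<open>The fort is the set of vertices that are never observed: an observed vertex with exactly
  one neighbour in it would force that neighbour.\<close>

lemma failed_power_dominating_imp_fort:
  assumes "failed_power_dominating G S"
  obtains U where "fort G U" "S \<inter> closed_nbhd_set G U = {}"
proof
  let ?U = "verts G - observed_lim G S"
  have S: "S \<subseteq> verts G" and lim: "observed_lim G S \<noteq> verts G"
    using assms by (auto simp: failed_power_dominating_def power_dominating_def)
  have lim_sub: "observed_lim G S \<subseteq> verts G"
    unfolding observed_lim_def using observed_subset_verts[OF S] by blast
  \<comment> \<open>A stage at which the process is stationary, so that a vertex forced at stage
    \<open>Suc i\<close> would already belong to the limit.\<close>
  obtain i where i: "observed G S i = observed_lim G S"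
    using observed_eventually[OF S] by (auto simp: eventually_sequentially)
  have "closed_nbhd G v \<inter> ?U \<noteq> {w}" if "v \<in> verts G - ?U" for v w
  proof
    assume w: "closed_nbhd G v \<inter> ?U = {w}"
    have "closed_nbhd G v - observed G S i = {w}"
      using w that closed_nbhd_subset_verts[of v] unfolding i by blast
    then have "w \<in> observed G S (Suc i)" using that i by auto
    then show False using w unfolding observed_lim_def by blast
  qed
  then show "fort G ?U" using lim lim_sub unfolding fort_def by blast
  show "S \<inter> closed_nbhd_set G ?U = {}"
  proof (rule ccontr)
    assume "S \<inter> closed_nbhd_set G ?U \<noteq> {}"
    \<comment> \<open>A member \<open>v\<close> of \<open>S\<close> in the closed neighbourhood of
      an unobserved \<open>u\<close> would have put \<open>u\<close> into stage 0.\<close>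
    then obtain v u where "v \<in> S" "u \<in> ?U" "u \<in> closed_nbhd G v"
      using closed_nbhd_sym unfolding closed_nbhd_set_def by blast
    moreover from this have "u \<in> observed G S 0" by auto
    ultimately show False unfolding observed_lim_def by blast
  qed
qed

section \<open>The failed power domination number as a minimum over forts\<close>

lemma finite_failed_power_dominating: "finite {S. failed_power_dominating G S}"
  by (rule finite_subset[of _ "Pow (verts G)"]) (auto simp: failed_power_dominating_def)

text \<open>The complement of the closed neighbourhood of a fort is a failed power dominating set,
  and the maximum is at least its size.\<close>

lemma failed_power_domination_number_ge:
  assumes "fort G U"
  shows "int (card (verts G)) - int (card (closed_nbhd_set G U)) \<le>
    int (failed_power_domination_number G)"
proof -
  have sub: "closed_nbhd_set G U \<subseteq> verts G"
    using assms closed_nbhd_set_subset_verts by (auto simp: fort_def)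
  have "card (verts G - closed_nbhd_set G U) \<le> failed_power_domination_number G"
    unfolding failed_power_domination_number_def
    using fort_imp_failed_power_dominating[OF assms] finite_failed_power_dominating
    by (intro Max_ge) auto
  then show ?thesis
    using card_Diff_subset[OF finite_subset[OF sub finite_verts] sub] by linarith
qed

text \<open>A maximum failed set \<open>S\<close> is disjoint from N[U] for some fort
  \<open>U\<close>, so the two sizes add up to at most the order of the graph; the preceding bound
  gives the other inequality.\<close>

lemma failed_power_domination_number_attained:
  assumes "verts G \<noteq> {}"
  obtains U where "fort G U"
    "int (failed_power_domination_number G) =
      int (card (verts G)) - int (card (closed_nbhd_set G U))"
proof -
  \<comment> \<open>Vacuously a fort, as no vertex lies outside; so failed sets exist and the
    maximum is taken over a nonempty set.\<close>
  have "fort G (verts G)" using assms by (simp add: fort_def)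
  then have "{S. failed_power_dominating G S} \<noteq> {}"
    using fort_imp_failed_power_dominating by blast
  then have "failed_power_domination_number G \<in> card ` {S. failed_power_dominating G S}"
    unfolding failed_power_domination_number_def
    using finite_failed_power_dominating by (intro Max_in) auto
  then obtain S where S: "failed_power_dominating G S" "failed_power_domination_number G = card S"
    by blast
  obtain U where U: "fort G U" "S \<inter> closed_nbhd_set G U = {}"
    using failed_power_dominating_imp_fort[OF S(1)] .
  have sub: "S \<subseteq> verts G" "closed_nbhd_set G U \<subseteq> verts G"
    using S(1) U(1) closed_nbhd_set_subset_verts
    by (auto simp: failed_power_dominating_def fort_def)
  then have "finite S" "finite (closed_nbhd_set G U)"
    using finite_subset[OF _ finite_verts] by blast+
  then have "card S + card (closed_nbhd_set G U) = card (S \<union> closed_nbhd_set G U)"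
    using U(2) by (simp add: card_Un_disjoint)
  also have "\<dots> \<le> card (verts G)" using sub by (intro card_mono) auto
  finally show ?thesis
    using that[OF U(1)] failed_power_domination_number_ge[OF U(1)] S(2) by linarith
qed

text \<open>The right-hand side says that \<open>k\<close> is the minimum of |N[U]| over forts: it
  is attained and it is a lower bound.\<close>

lemma failed_power_domination_number_eq_iff:
  assumes "verts G \<noteq> {}"
  shows "int (failed_power_domination_number G) = int (card (verts G)) - int k \<longleftrightarrow>
    (\<exists>U. fort G U \<and> card (closed_nbhd_set G U) = k) \<and>
    (\<forall>U. fort G U \<longrightarrow> k \<le> card (closed_nbhd_set G U))"
proof -
  obtain U where U: "fort G U" "int (failed_power_domination_number G) =
      int (card (verts G)) - int (card (closed_nbhd_set G U))"
    using failed_power_domination_number_attained[OF assms] .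
  have "card (closed_nbhd_set G U) \<le> card (closed_nbhd_set G V)" if "fort G V" for V
    using failed_power_domination_number_ge[OF that] U(2) by linarith
  then have "card (closed_nbhd_set G U) = k \<longleftrightarrow>
      (\<exists>V. fort G V \<and> card (closed_nbhd_set G V) = k) \<and>
      (\<forall>V. fort G V \<longrightarrow> k \<le> card (closed_nbhd_set G V))"
    using U(1) by (metis le_antisym)
  then show ?thesis unfolding U(2) by simp
qed

lemma card_closed_nbhd_set_pos:
  assumes "fort G U"
  shows "1 \<le> card (closed_nbhd_set G U)"
proof -
  have "finite (closed_nbhd_set G U)"
    using assms closed_nbhd_set_subset_verts finite_subset[OF _ finite_verts]
    by (auto simp: fort_def)
  moreover have "closed_nbhd_set G U \<noteq> {}"
    using assms subset_closed_nbhd_set[of U] by (auto simp: fort_def)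
  ultimately show ?thesis by (simp add: Suc_le_eq card_gt_0_iff)
qed

section \<open>Forts with a closed neighbourhood of at most three vertices\<close>

text \<open>An outside vertex sees both twins or neither, hence never exactly one. Whether
  \<open>x\<close> and \<open>y\<close> are adjacent is left open, so this covers the edge
  component, the ends of a pendant path and two corners of a pendant triangle.\<close>

lemma fort_twins:
  assumes "x \<in> verts G" "y \<in> verts G" "x \<noteq> y"
    "\<And>v. v \<noteq> x \<Longrightarrow> v \<noteq> y \<Longrightarrow> x \<rightarrow> v \<longleftrightarrow> y \<rightarrow> v"
  shows "fort G {x, y}"
proof -
  have "closed_nbhd G v \<inter> {x, y} \<noteq> {w}" if "v \<in> verts G - {x, y}" for v w
  proof
    assume w: "closed_nbhd G v \<inter> {x, y} = {w}"
    have "x \<in> closed_nbhd G v \<longleftrightarrow> y \<in> closed_nbhd G v"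
      using that assms(4)[of v] adj_sym[of x v] adj_sym[of y v] by (auto simp: closed_nbhd_def)
    moreover have "w \<in> closed_nbhd G v \<inter> {x, y}" unfolding w by simp
    ultimately have "x \<in> closed_nbhd G v \<inter> {x, y}" "y \<in> closed_nbhd G v \<inter> {x, y}" by auto
    then show False using assms(3) unfolding w by simp
  qed
  then show ?thesis using assms(1,2) unfolding fort_def by blast
qed

text \<open>Since \<open>u\<close> cannot be the only neighbour of \<open>v\<close> in
  \<open>U\<close>, there is a second one; it differs from \<open>v\<close> because \<open>v\<close>
  is outside \<open>U\<close>.\<close>

lemma fort_adj:
  assumes "fort G U" "u \<in> U" "u \<rightarrow> v" "v \<notin> U"
  obtains w where "w \<in> U" "w \<noteq> u" "v \<rightarrow> w"
proof -
  have "v \<in> verts G - U" using assms adj_in_verts(2) by blast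
  then have "closed_nbhd G v \<inter> U \<noteq> {u}" using assms(1) unfolding fort_def by blast
  moreover have "u \<in> closed_nbhd G v \<inter> U"
    using assms(2,3) adj_sym by (auto simp: closed_nbhd_def)
  ultimately show ?thesis using that assms(4) by (auto simp: closed_nbhd_def)
qed

text \<open>Any neighbour of \<open>u\<close> would have \<open>u\<close> as its only neighbour in
  the fort, so a one-vertex fort consists of an isolated vertex.\<close>

lemma fort_not_singleton:
  assumes "fort G U" "\<nexists>v. isolated_vertex G v"
  shows "U \<noteq> {u}"
proof
  assume U: "U = {u}"
  then have "u \<in> verts G" using assms(1) by (auto simp: fort_def)
  then obtain v where v: "u \<rightarrow> v" using assms(2) by (auto simp: isolated_vertex_def)
  then have "v \<notin> U" using U adj_irrefl by auto
  then show False using fort_adj[OF assms(1) _ v] U by auto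
qed

section \<open>Classification by the size of the closed neighbourhood: one, two, three\<close>

lemma isolated_vertex_iff_fort:
  "(\<exists>v. isolated_vertex G v) \<longleftrightarrow> (\<exists>U. fort G U \<and> card (closed_nbhd_set G U) = 1)"
proof
  assume "\<exists>v. isolated_vertex G v"
  then obtain v where v: "v \<in> verts G" "\<And>w. \<not> v \<rightarrow> w" by (auto simp: isolated_vertex_def)
  have "fort G {v}"
    using v adj_sym[of v] by (auto simp: fort_def closed_nbhd_def)
  moreover have "closed_nbhd_set G {v} = {v}"
    using v by (auto simp: closed_nbhd_set_def closed_nbhd_def)
  ultimately show "\<exists>U. fort G U \<and> card (closed_nbhd_set G U) = 1"
    by (intro exI[of _ "{v}"]) simp
next
  assume "\<exists>U. fort G U \<and> card (closed_nbhd_set G U) = 1"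
  then obtain U x where U: "fort G U" "closed_nbhd_set G U = {x}" by (auto simp: card_1_singleton_iff)
  then have "U = {x}" using subset_closed_nbhd_set[of U] by (auto simp: fort_def)
  then show "\<exists>v. isolated_vertex G v" using fort_not_singleton[OF U(1)] by blast
qed

text \<open>The left-hand side is a K2 component expressed by neighbourhoods. Its ends are twins;
  conversely a fort inside a two-element N[U] is not a singleton, hence fills N[U] and is closed
  under adjacency.\<close>

lemma edge_component_iff_fort:
  assumes "\<nexists>v. isolated_vertex G v"
  shows "(\<exists>x y. (\<forall>w. x \<rightarrow> w \<longleftrightarrow> w = y) \<and> (\<forall>w. y \<rightarrow> w \<longleftrightarrow> w = x)) \<longleftrightarrow>
    (\<exists>U. fort G U \<and> card (closed_nbhd_set G U) = 2)"
proof
  assume "\<exists>x y. (\<forall>w. x \<rightarrow> w \<longleftrightarrow> w = y) \<and> (\<forall>w. y \<rightarrow> w \<longleftrightarrow> w = x)"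
  then obtain x y where xy: "\<And>w. x \<rightarrow> w \<longleftrightarrow> w = y" "\<And>w. y \<rightarrow> w \<longleftrightarrow> w = x" by blast
  have "x \<noteq> y" using xy adj_irrefl by metis
  have "x \<in> verts G" "y \<in> verts G" using xy adj_in_verts by blast+
  then have "fort G {x, y}"
    using xy \<open>x \<noteq> y\<close> by (intro fort_twins) auto
  moreover have "closed_nbhd_set G {x, y} = {x, y}"
    using xy by (auto simp: closed_nbhd_set_def closed_nbhd_def)
  ultimately show "\<exists>U. fort G U \<and> card (closed_nbhd_set G U) = 2"
    using \<open>x \<noteq> y\<close> by (intro exI[of _ "{x, y}"]) simp
next
  assume "\<exists>U. fort G U \<and> card (closed_nbhd_set G U) = 2"
  then obtain U x y where U: "fort G U" "closed_nbhd_set G U = {x, y}" "x \<noteq> y"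
    by (auto simp: card_2_iff)
  have "U \<noteq> {}" "U \<subseteq> verts G" "U \<in> Pow {x, y}"
    using U(1,2) subset_closed_nbhd_set[of U] by (auto simp: fort_def)
  then have "U = {x, y}"
    using fort_not_singleton[OF U(1) assms] by (auto simp: Pow_insert)
  moreover have "w \<in> {x, y}" if "u \<in> U" "u \<rightarrow> w" for u w
    using that U(2) by (auto simp: closed_nbhd_set_def closed_nbhd_def)
  moreover have "\<exists>w. u \<rightarrow> w" if "u \<in> U" for u
    using that \<open>U \<subseteq> verts G\<close> assms by (auto simp: isolated_vertex_def)
  \<comment> \<open>Each of the two vertices has a neighbour, which lies in {x, y} and, without
    loops, must be the other one.\<close>
  ultimately have "(\<forall>w. x \<rightarrow> w \<longleftrightarrow> w = y) \<and> (\<forall>w. y \<rightarrow> w \<longleftrightarrow> w = x)"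
    by (metis adj_irrefl insert_iff singletonD)
  then show "\<exists>x y. (\<forall>w. x \<rightarrow> w \<longleftrightarrow> w = y) \<and> (\<forall>w. y \<rightarrow> w \<longleftrightarrow> w = x)" by blast
qed

text \<open>The two ends are nonadjacent twins with \<open>y\<close> as their only neighbour;
  \<open>y\<close> may have further neighbours.\<close>

lemma pendant_path_imp_fort:
  assumes "x \<noteq> z" "\<And>w. x \<rightarrow> w \<longleftrightarrow> w = y" "\<And>w. z \<rightarrow> w \<longleftrightarrow> w = y"
  shows "\<exists>U. fort G U \<and> card (closed_nbhd_set G U) = 3"
proof -
  have "x \<noteq> y" "z \<noteq> y" using assms adj_irrefl by metis+
  have "x \<in> verts G" "z \<in> verts G" using assms adj_in_verts by blast+
  then have "fort G {x, z}"
    using assms by (intro fort_twins) auto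
  moreover have "closed_nbhd_set G {x, z} = {x, y, z}"
    using assms by (auto simp: closed_nbhd_set_def closed_nbhd_def)
  ultimately show ?thesis
    using \<open>x \<noteq> y\<close> \<open>z \<noteq> y\<close> assms(1) by (intro exI[of _ "{x, z}"]) auto
qed

text \<open>Here \<open>x\<close> and \<open>y\<close> are adjacent twins, and \<open>z\<close> is
  the corner that may have further neighbours.\<close>

lemma pendant_triangle_imp_fort:
  assumes "x \<noteq> y" "\<And>w. x \<rightarrow> w \<longleftrightarrow> w = y \<or> w = z" "\<And>w. y \<rightarrow> w \<longleftrightarrow> w = x \<or> w = z"
  shows "\<exists>U. fort G U \<and> card (closed_nbhd_set G U) = 3"
proof -
  have "x \<noteq> z" "y \<noteq> z" using assms adj_irrefl by metis+
  have "x \<in> verts G" "y \<in> verts G" using assms adj_in_verts by blast+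
  then have "fort G {x, y}"
    using assms by (intro fort_twins) auto
  moreover have "closed_nbhd_set G {x, y} = {x, y, z}"
    using assms by (auto simp: closed_nbhd_set_def closed_nbhd_def)
  ultimately show ?thesis
    using \<open>x \<noteq> z\<close> \<open>y \<noteq> z\<close> assms(1) by (intro exI[of _ "{x, y}"]) auto
qed

text \<open>The fort has at least two vertices \<open>x\<close> and \<open>y\<close>, and
  \<open>z\<close> is the third vertex of N[U]. Either \<open>U\<close> is all of N[U], a set closed
  under adjacency without isolated vertices, or \<open>U\<close> is {x, y} and \<open>z\<close> is
  adjacent to both.\<close>

lemma fort_card_3_cases:
  assumes "fort G U" "card (closed_nbhd_set G U) = 3" "\<nexists>v. isolated_vertex G v"
  shows "(\<exists>x y z. x \<noteq> z \<and> (\<forall>w. x \<rightarrow> w \<longleftrightarrow> w = y) \<and> (\<forall>w. z \<rightarrow> w \<longleftrightarrow> w = y)) \<or>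
    (\<exists>x y z. x \<noteq> y \<and> (\<forall>w. x \<rightarrow> w \<longleftrightarrow> w = y \<or> w = z) \<and> (\<forall>w. y \<rightarrow> w \<longleftrightarrow> w = x \<or> w = z))"
    (is "?path \<or> ?triangle")
proof -
  have U: "U \<noteq> {}" "U \<subseteq> verts G" using assms(1) by (auto simp: fort_def)
  obtain x where "x \<in> U" using U by blast
  obtain y where "y \<in> U" "y \<noteq> x"
    using \<open>x \<in> U\<close> fort_not_singleton[OF assms(1,3), of x] by blast
  have sub: "U \<subseteq> closed_nbhd_set G U" by (rule subset_closed_nbhd_set)
  \<comment> \<open>\<open>card\<close> is 0 on infinite sets, so the value 3 forces
    finiteness.\<close>
  have fin: "finite (closed_nbhd_set G U)" using assms(2) card.infinite by fastforce
  have "card (closed_nbhd_set G U - {x, y}) = 1"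
    using \<open>x \<in> U\<close> \<open>y \<in> U\<close> \<open>y \<noteq> x\<close> sub assms(2) fin by (subst card_Diff_subset) auto
  then obtain z where "closed_nbhd_set G U - {x, y} = {z}" by (auto simp: card_1_singleton_iff)
  then have N: "closed_nbhd_set G U = {x, y, z}" and z: "z \<noteq> x" "z \<noteq> y"
    using \<open>x \<in> U\<close> \<open>y \<in> U\<close> sub by blast+
  have nb: "w = x \<or> w = y \<or> w = z" if "u \<in> U" "u \<rightarrow> w" for u w
    using that N by (auto simp: closed_nbhd_set_def closed_nbhd_def)
  have ex: "\<exists>w. u \<rightarrow> w" if "u \<in> U" for u
    using that U assms(3) by (auto simp: isolated_vertex_def)
  \<comment> \<open>The neighbourhoods inside {x, y, z} are determined by which of the three
    possible edges are present.\<close>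
  have x: "x \<rightarrow> w \<longleftrightarrow> w = y \<and> x \<rightarrow> y \<or> w = z \<and> x \<rightarrow> z" for w
    using nb[OF \<open>x \<in> U\<close>, of w] by auto
  have y: "y \<rightarrow> w \<longleftrightarrow> w = x \<and> x \<rightarrow> y \<or> w = z \<and> y \<rightarrow> z" for w
    using nb[OF \<open>y \<in> U\<close>, of w] adj_sym[of x y] by auto
  show ?thesis
  proof (cases "z \<in> U")
    case True
    have z': "z \<rightarrow> w \<longleftrightarrow> w = x \<and> x \<rightarrow> z \<or> w = y \<and> y \<rightarrow> z" for w
      using nb[OF True, of w] adj_sym[of x z] adj_sym[of y z] by auto
    have "x \<rightarrow> y \<or> x \<rightarrow> z" "x \<rightarrow> y \<or> y \<rightarrow> z" "x \<rightarrow> z \<or> y \<rightarrow> z"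
      using ex[OF \<open>x \<in> U\<close>] x ex[OF \<open>y \<in> U\<close>] y ex[OF True] z' by blast+
    \<comment> \<open>Each vertex lies on an edge, so at least two of the three edges are present: a
      triangle, or a path with one of three possible middle vertices.\<close>
    then consider "x \<rightarrow> y" "x \<rightarrow> z" "y \<rightarrow> z" | "x \<rightarrow> y" "x \<rightarrow> z" "\<not> y \<rightarrow> z"
      | "x \<rightarrow> y" "\<not> x \<rightarrow> z" "y \<rightarrow> z" | "\<not> x \<rightarrow> y" "x \<rightarrow> z" "y \<rightarrow> z"
      by blast
    then show ?thesis
    proof cases
      case 1
      have "(\<forall>w. x \<rightarrow> w \<longleftrightarrow> w = y \<or> w = z) \<and> (\<forall>w. y \<rightarrow> w \<longleftrightarrow> w = x \<or> w = z)"
        using 1 x y by blast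
      then show ?thesis using \<open>y \<noteq> x\<close> by blast
    next
      case 2
      have "(\<forall>w. y \<rightarrow> w \<longleftrightarrow> w = x) \<and> (\<forall>w. z \<rightarrow> w \<longleftrightarrow> w = x)" using 2 y z' by blast
      then show ?thesis using z by blast
    next
      case 3
      have "(\<forall>w. x \<rightarrow> w \<longleftrightarrow> w = y) \<and> (\<forall>w. z \<rightarrow> w \<longleftrightarrow> w = y)" using 3 x z' by blast
      then show ?thesis using z by blast
    next
      case 4
      have "(\<forall>w. x \<rightarrow> w \<longleftrightarrow> w = z) \<and> (\<forall>w. y \<rightarrow> w \<longleftrightarrow> w = z)" using 4 x y by blast
      then show ?thesis using \<open>y \<noteq> x\<close> by blast
    qed
  next
    case False
    then have U_eq: "U = {x, y}" using sub N \<open>x \<in> U\<close> \<open>y \<in> U\<close> by blast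
    \<comment> \<open>As \<open>z\<close> is in N[U] but not in \<open>U\<close>, it has a neighbour
      in \<open>U\<close>; the fort condition then supplies the other one.\<close>
    have "x \<rightarrow> z \<or> y \<rightarrow> z"
      using N z U_eq by (auto simp: closed_nbhd_set_def closed_nbhd_def)
    then have xz: "x \<rightarrow> z" and yz: "y \<rightarrow> z"
      using fort_adj[OF assms(1) _ _ False] U_eq adj_sym by blast+
    show ?thesis
    proof (cases "x \<rightarrow> y")
      case True
      have "(\<forall>w. x \<rightarrow> w \<longleftrightarrow> w = y \<or> w = z) \<and> (\<forall>w. y \<rightarrow> w \<longleftrightarrow> w = x \<or> w = z)"
        using True xz yz x y by blast
      then show ?thesis using \<open>y \<noteq> x\<close> by blast
    next
      case False
      have "(\<forall>w. x \<rightarrow> w \<longleftrightarrow> w = z) \<and> (\<forall>w. y \<rightarrow> w \<longleftrightarrow> w = z)"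
        using False xz yz x y by blast
      then show ?thesis using \<open>y \<noteq> x\<close> by blast
    qed
  qed
qed

lemma pendant_path_or_triangle_iff_fort:
  assumes "\<nexists>v. isolated_vertex G v"
  shows "(\<exists>x y z. x \<noteq> z \<and> (\<forall>w. x \<rightarrow> w \<longleftrightarrow> w = y) \<and> (\<forall>w. z \<rightarrow> w \<longleftrightarrow> w = y)) \<or>
      (\<exists>x y z. x \<noteq> y \<and> (\<forall>w. x \<rightarrow> w \<longleftrightarrow> w = y \<or> w = z) \<and> (\<forall>w. y \<rightarrow> w \<longleftrightarrow> w = x \<or> w = z)) \<longleftrightarrow>
    (\<exists>U. fort G U \<and> card (closed_nbhd_set G U) = 3)" (is "?path \<or> ?triangle \<longleftrightarrow> ?fort")
proof
  assume "?path \<or> ?triangle"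
  then show ?fort
  proof (elim disjE exE conjE)
    show ?fort if "x \<noteq> z" "\<forall>w. x \<rightarrow> w \<longleftrightarrow> w = y" "\<forall>w. z \<rightarrow> w \<longleftrightarrow> w = y" for x y z
      using that(1) that(2,3)[rule_format] by (rule pendant_path_imp_fort)
    show ?fort if "x \<noteq> y" "\<forall>w. x \<rightarrow> w \<longleftrightarrow> w = y \<or> w = z" "\<forall>w. y \<rightarrow> w \<longleftrightarrow> w = x \<or> w = z" for x y z
      using that(1) that(2,3)[rule_format] by (rule pendant_triangle_imp_fort)
  qed
next
  assume ?fort
  then show "?path \<or> ?triangle" using fort_card_3_cases[OF _ _ assms] by (elim exE conjE)
qed

section \<open>Components and induced subgraphs\<close>

text \<open>Arcs come in opposite pairs, so the ends of an arc are mutually reachable and share a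
  strong component.\<close>

lemma sccs_adj_closed:
  assumes "C \<in> sccs" "u \<in> verts C" "u \<rightarrow> v"
  shows "v \<in> verts C"
proof -
  have "verts C \<in> sccs_verts" using assms(1) sccs_verts_conv by blast
  moreover have "u \<rightarrow>\<^sup>* v" "v \<rightarrow>\<^sup>* u" using assms(3) adj_sym by auto
  ultimately show ?thesis using assms(2) unfolding in_sccs_verts_conv_reachable by blast
qed

text \<open>Closure under adjacency extends to reachability, so \<open>S\<close> is a full class of
  mutually reachable vertices.\<close>

lemma adj_closed_in_sccs:
  assumes "S \<noteq> {}" "\<And>u v. u \<in> S \<Longrightarrow> v \<in> S \<Longrightarrow> u \<rightarrow>\<^sup>* v" "\<And>u v. u \<in> S \<Longrightarrow> u \<rightarrow> v \<Longrightarrow> v \<in> S"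
  shows "G \<restriction> S \<in> sccs"
proof -
  have "v \<in> S" if "u \<rightarrow>\<^sup>* v" "u \<in> S" for u v
    using that(1) by (induction rule: reachable_induct) (use that(2) assms(3) in auto)
  then show ?thesis
    using assms(1,2) unfolding in_sccs_verts_conv[symmetric] in_sccs_verts_conv_reachable by blast
qed

lemma singleton_component_iff:
  "(\<exists>C \<in> sccs. \<exists>v. isolated_vertex G v \<and> verts C = {v}) \<longleftrightarrow> (\<exists>v. isolated_vertex G v)"
proof
  assume "\<exists>v. isolated_vertex G v"
  then obtain v where v: "isolated_vertex G v" ..
  then have "G \<restriction> {v} \<in> sccs" by (intro adj_closed_in_sccs) (auto simp: isolated_vertex_def)
  then show "\<exists>C \<in> sccs. \<exists>v. isolated_vertex G v \<and> verts C = {v}"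
    using v by (intro bexI[of _ "G \<restriction> {v}"] exI[of _ v]) auto
qed blast

text \<open>Translates a K2 component into the neighbourhood conditions used for forts: components
  are closed under adjacency, and conversely the pair {x, y} is connected and closed.\<close>

lemma edge_component_iff:
  "(\<exists>C \<in> sccs. complete_digraph 2 C) \<longleftrightarrow>
    (\<exists>x y. (\<forall>w. x \<rightarrow> w \<longleftrightarrow> w = y) \<and> (\<forall>w. y \<rightarrow> w \<longleftrightarrow> w = x))"
proof
  assume "\<exists>C \<in> sccs. complete_digraph 2 C"
  then obtain C where C: "C \<in> sccs" "complete_digraph 2 C" ..
  then obtain x y where xy: "verts C = {x, y}" "x \<noteq> y"
    by (auto simp: complete_digraph_def card_2_iff)
  have "x \<rightarrow>\<^bsub>C\<^esub> y" using C(2) xy by (auto simp: complete_digraph_def)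
  then have "x \<rightarrow> y" using arcs_ends_induced[OF in_sccs_imp_induced[OF C(1)]] by blast
  then have "(\<forall>w. x \<rightarrow> w \<longleftrightarrow> w = y) \<and> (\<forall>w. y \<rightarrow> w \<longleftrightarrow> w = x)"
    using sccs_adj_closed[OF C(1)] xy adj_sym adj_irrefl by (metis insert_iff singletonD)
  then show "\<exists>x y. (\<forall>w. x \<rightarrow> w \<longleftrightarrow> w = y) \<and> (\<forall>w. y \<rightarrow> w \<longleftrightarrow> w = x)" by blast
next
  assume "\<exists>x y. (\<forall>w. x \<rightarrow> w \<longleftrightarrow> w = y) \<and> (\<forall>w. y \<rightarrow> w \<longleftrightarrow> w = x)"
  then obtain x y where xy: "\<And>w. x \<rightarrow> w \<longleftrightarrow> w = y" "\<And>w. y \<rightarrow> w \<longleftrightarrow> w = x" by blast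
  have "x \<noteq> y" using xy adj_irrefl by metis
  have verts: "x \<in> verts G" "y \<in> verts G" using xy adj_in_verts by blast+
  then have scc: "G \<restriction> {x, y} \<in> sccs"
    using xy by (intro adj_closed_in_sccs) auto
  have ind: "induced_subgraph (G \<restriction> {x, y}) G" using scc by (rule in_sccs_imp_induced)
  have "complete_digraph 2 (G \<restriction> {x, y})"
    unfolding complete_digraph_def
  proof (intro conjI set_eqI)
    show "graph (G \<restriction> {x, y})" using ind by (rule graph_induced)
    show "card (verts (G \<restriction> {x, y})) = 2" using \<open>x \<noteq> y\<close> by simp
    show "e \<in> arcs_ends (G \<restriction> {x, y}) \<longleftrightarrow>
        e \<in> {(u, v). (u, v) \<in> verts (G \<restriction> {x, y}) \<times> verts (G \<restriction> {x, y}) \<and> u \<noteq> v}" for e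
      using xy \<open>x \<noteq> y\<close> by (cases e) (auto simp: arcs_ends_induced[OF ind])
  qed
  then show "\<exists>C \<in> sccs. complete_digraph 2 C" using scc by blast
qed

lemma path_graph_3_iff:
  "path_graph [x, y, z] H \<longleftrightarrow> graph H \<and> distinct [x, y, z] \<and> verts H = {x, y, z} \<and>
    arcs_ends H = {(x, y), (y, x), (y, z), (z, y)}"
proof -
  have "{([x, y, z] ! i, [x, y, z] ! j) | i j. i < length [x, y, z] \<and> j < length [x, y, z] \<and>
      (j = Suc i \<or> i = Suc j)} = {(x, y), (y, x), (y, z), (z, y)}" (is "?L = ?R")
  proof
    show "?L \<subseteq> ?R" by (auto simp: less_Suc_eq)
    show "?R \<subseteq> ?L"
    proof -
      \<comment> \<open>Kept in indexed form so that the positions themselves witness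
        \<open>i\<close> and \<open>j\<close>.\<close>
      have "([x, y, z] ! 0, [x, y, z] ! 1) \<in> ?L" "([x, y, z] ! 1, [x, y, z] ! 0) \<in> ?L"
        "([x, y, z] ! 1, [x, y, z] ! 2) \<in> ?L" "([x, y, z] ! 2, [x, y, z] ! 1) \<in> ?L"
        by fastforce+
      then show ?thesis by simp
    qed
  qed
  then show ?thesis unfolding path_graph_def by simp
qed

text \<open>The boundary condition keeps all neighbours of the two ends inside the induced path,
  where adjacency is known.\<close>

lemma pendant_path_iff:
  "(\<exists>H x y z. induced_subgraph H G \<and> path_graph [x, y, z] H \<and> boundary_verts G H \<subseteq> {y}) \<longleftrightarrow>
    (\<exists>x y z. x \<noteq> z \<and> (\<forall>w. x \<rightarrow> w \<longleftrightarrow> w = y) \<and> (\<forall>w. z \<rightarrow> w \<longleftrightarrow> w = y))"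
proof
  assume "\<exists>H x y z. induced_subgraph H G \<and> path_graph [x, y, z] H \<and> boundary_verts G H \<subseteq> {y}"
  then obtain H x y z where H: "induced_subgraph H G" "path_graph [x, y, z] H"
    "boundary_verts G H \<subseteq> {y}" by blast
  note path = H(2)[unfolded path_graph_3_iff]
  have in_H: "w \<in> verts H" if "u \<in> verts H" "u \<noteq> y" "u \<rightarrow> w" for u w
    using that H(3) adj_in_verts(2) unfolding boundary_verts_def by blast
  have "u \<rightarrow> w \<longleftrightarrow> w = y" if "u = x \<or> u = z" for u w
  proof -
    have "u \<rightarrow> w \<longleftrightarrow> u \<rightarrow>\<^bsub>H\<^esub> w"
      using in_H[of u w] that path arcs_ends_induced[OF H(1)] by auto
    then show ?thesis using path that by auto
  qed
  then show "\<exists>x y z. x \<noteq> z \<and> (\<forall>w. x \<rightarrow> w \<longleftrightarrow> w = y) \<and> (\<forall>w. z \<rightarrow> w \<longleftrightarrow> w = y)"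
    using path by (intro exI[of _ x] exI[of _ y] exI[of _ z]) auto
next
  assume "\<exists>x y z. x \<noteq> z \<and> (\<forall>w. x \<rightarrow> w \<longleftrightarrow> w = y) \<and> (\<forall>w. z \<rightarrow> w \<longleftrightarrow> w = y)"
  then obtain x y z where xyz: "x \<noteq> z" "\<And>w. x \<rightarrow> w \<longleftrightarrow> w = y" "\<And>w. z \<rightarrow> w \<longleftrightarrow> w = y" by blast
  let ?H = "G \<restriction> {x, y, z}"
  have neq: "x \<noteq> y" "z \<noteq> y" using xyz adj_irrefl by metis+
  have "{x, y, z} \<subseteq> verts G" using xyz adj_in_verts by blast
  then have ind: "induced_subgraph ?H G" by (rule induced_induce)
  \<comment> \<open>The ends \<open>x\<close> and \<open>z\<close> must be nonadjacent, because the
    subgraph is induced.\<close>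
  have adj: "x \<rightarrow> y" "y \<rightarrow> x" "y \<rightarrow> z" "z \<rightarrow> y" "\<not> x \<rightarrow> z" "\<not> z \<rightarrow> x"
    using neq xyz(2,3) adj_sym[of y x] adj_sym[of y z] by simp_all
  have "path_graph [x, y, z] ?H"
    unfolding path_graph_3_iff
  proof (intro conjI set_eqI)
    show "graph ?H" using ind by (rule graph_induced)
    show "distinct [x, y, z]" using neq xyz(1) by simp
    show "e \<in> arcs_ends ?H \<longleftrightarrow> e \<in> {(x, y), (y, x), (y, z), (z, y)}" for e
      using neq xyz(1) adj by (cases e) (auto simp: arcs_ends_induced[OF ind])
  qed simp
  moreover have "boundary_verts G ?H \<subseteq> {y}" using xyz by (auto simp: boundary_verts_def)
  ultimately show "\<exists>H x y z. induced_subgraph H G \<and> path_graph [x, y, z] H \<and>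
      boundary_verts G H \<subseteq> {y}"
    using ind by blast
qed

text \<open>With at most one boundary vertex, two corners have all their neighbours inside the
  triangle; these become \<open>x\<close> and \<open>y\<close>.\<close>

lemma pendant_triangle_iff:
  "(\<exists>H. induced_subgraph H G \<and> complete_digraph 3 H \<and> card (boundary_verts G H) \<le> 1) \<longleftrightarrow>
    (\<exists>x y z. x \<noteq> y \<and> (\<forall>w. x \<rightarrow> w \<longleftrightarrow> w = y \<or> w = z) \<and> (\<forall>w. y \<rightarrow> w \<longleftrightarrow> w = x \<or> w = z))"
proof
  assume "\<exists>H. induced_subgraph H G \<and> complete_digraph 3 H \<and> card (boundary_verts G H) \<le> 1"
  then obtain H where H: "induced_subgraph H G" "complete_digraph 3 H"
    "card (boundary_verts G H) \<le> 1" by blast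
  let ?B = "boundary_verts G H"
  have card: "card (verts H) = 3" using H(2) by (simp add: complete_digraph_def)
  then have fin: "finite (verts H)" using card.infinite by fastforce
  have sub: "?B \<subseteq> verts H" by (auto simp: boundary_verts_def)
  then have "2 \<le> card (verts H - ?B)"
    using card H(3) finite_subset[OF sub fin] by (simp add: card_Diff_subset)
  \<comment> \<open>Two corners off the boundary; the remaining corner \<open>z\<close> may or may
    not be a boundary vertex.\<close>
  then obtain T where T: "T \<subseteq> verts H - ?B" "card T = 2"
    using obtain_subset_with_card_n by metis
  then obtain x y where xy: "T = {x, y}" "x \<noteq> y" by (auto simp: card_2_iff)
  have "card (verts H - {x, y}) = 1" using card T xy by (subst card_Diff_subset) auto
  then obtain z where "verts H - {x, y} = {z}" by (auto simp: card_1_singleton_iff)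
  then have verts_H: "verts H = {x, y, z}" and z: "z \<noteq> x" "z \<noteq> y" using T xy by blast+
  have "u \<rightarrow> w \<longleftrightarrow> w \<in> verts H - {u}" if "u = x \<or> u = y" for u w
  proof -
    have u: "u \<in> verts H" "u \<notin> ?B" using that T(1) xy by auto
    then have "u \<rightarrow> w \<longleftrightarrow> u \<rightarrow>\<^bsub>H\<^esub> w"
      using adj_in_verts(2) arcs_ends_induced[OF H(1)] unfolding boundary_verts_def by blast
    then show ?thesis using u(1) H(2) by (auto simp: complete_digraph_def)
  qed
  then show "\<exists>x y z. x \<noteq> y \<and> (\<forall>w. x \<rightarrow> w \<longleftrightarrow> w = y \<or> w = z) \<and> (\<forall>w. y \<rightarrow> w \<longleftrightarrow> w = x \<or> w = z)"
    using verts_H z xy(2) by (intro exI[of _ x] exI[of _ y] exI[of _ z]) auto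
next
  assume "\<exists>x y z. x \<noteq> y \<and> (\<forall>w. x \<rightarrow> w \<longleftrightarrow> w = y \<or> w = z) \<and> (\<forall>w. y \<rightarrow> w \<longleftrightarrow> w = x \<or> w = z)"
  then obtain x y z where xyz: "x \<noteq> y" "\<And>w. x \<rightarrow> w \<longleftrightarrow> w = y \<or> w = z"
    "\<And>w. y \<rightarrow> w \<longleftrightarrow> w = x \<or> w = z" by blast
  let ?H = "G \<restriction> {x, y, z}"
  have neq: "z \<noteq> x" "z \<noteq> y" using xyz adj_irrefl by metis+
  have "{x, y, z} \<subseteq> verts G" using xyz adj_in_verts by blast
  then have ind: "induced_subgraph ?H G" by (rule induced_induce)
  have adj: "x \<rightarrow> y" "y \<rightarrow> x" "y \<rightarrow> z" "z \<rightarrow> y" "x \<rightarrow> z" "z \<rightarrow> x"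
    using xyz(2,3) adj_sym[of z x] adj_sym[of z y] by simp_all
  have "complete_digraph 3 ?H"
    unfolding complete_digraph_def
  proof (intro conjI set_eqI)
    show "graph ?H" using ind by (rule graph_induced)
    show "card (verts ?H) = 3" using neq xyz(1) by simp
    show "e \<in> arcs_ends ?H \<longleftrightarrow>
        e \<in> {(u, v). (u, v) \<in> verts ?H \<times> verts ?H \<and> u \<noteq> v}" for e
      using neq xyz(1) adj by (cases e) (auto simp: arcs_ends_induced[OF ind])
  qed
  moreover have "boundary_verts G ?H \<subseteq> {z}" using xyz by (auto simp: boundary_verts_def)
  then have "card (boundary_verts G ?H) \<le> 1" using card_mono[of "{z}"] by fastforce
  ultimately show "\<exists>H. induced_subgraph H G \<and> complete_digraph 3 H \<and>
      card (boundary_verts G H) \<le> 1"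
    using ind by blast
qed

end

text \<open>The differences are taken in the integers: truncated subtraction would identify n - 1, n
  - 2 and n - 3 when n = 1.\<close>

theorem theorem2:
  fixes G :: "('a, 'b) pre_digraph" and n :: nat
  assumes "graph G" and "verts G \<noteq> {}" and "n = card (verts G)"
  shows "(int (failed_power_domination_number G) = int n - 1 \<longleftrightarrow> (\<exists>v. isolated_vertex G v)) \<and>
    (int (failed_power_domination_number G) = int n - 2 \<longleftrightarrow>
      (\<exists>C \<in> pre_digraph.sccs G. complete_digraph 2 C) \<and> \<not> (\<exists>v. isolated_vertex G v)) \<and>
    (int (failed_power_domination_number G) = int n - 3 \<longleftrightarrow>
      \<not> (\<exists>C \<in> pre_digraph.sccs G.
          (\<exists>v. isolated_vertex G v \<and> verts C = {v}) \<or> complete_digraph 2 C) \<and>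
      ((\<exists>H x y z. induced_subgraph H G \<and> path_graph [x, y, z] H \<and> boundary_verts G H \<subseteq> {y}) \<or>
       (\<exists>H. induced_subgraph H G \<and> complete_digraph 3 H \<and> card (boundary_verts G H) \<le> 1)))"
proof -
  interpret graph G by fact
  let ?fort = "\<lambda>k. \<exists>U. fort G U \<and> card (closed_nbhd_set G U) = k"
  let ?path = "\<exists>H x y z. induced_subgraph H G \<and> path_graph [x, y, z] H \<and> boundary_verts G H \<subseteq> {y}"
  let ?triangle = "\<exists>H. induced_subgraph H G \<and> complete_digraph 3 H \<and> card (boundary_verts G H) \<le> 1"
  \<comment> \<open>The minimum is \<open>k\<close> exactly if \<open>k\<close> is attained and no
    smaller value is.\<close>
  have fpd: "int (failed_power_domination_number G) = int n - int k \<longleftrightarrow>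
      ?fort k \<and> (\<forall>j<k. \<not> ?fort j)" for k
    unfolding assms(3) failed_power_domination_number_eq_iff[OF assms(2)]
    by (metis linorder_not_less)
  have fort_0: "\<not> ?fort 0" using card_closed_nbhd_set_pos by fastforce
  have isolated: "(\<exists>v. isolated_vertex G v) \<longleftrightarrow> ?fort 1" by (rule isolated_vertex_iff_fort)
  \<comment> \<open>The characterisations for two and three presuppose that there are no isolated
    vertices, which is here \<open>\<not> ?fort 1\<close>.\<close>
  have edge: "(\<exists>C \<in> sccs. complete_digraph 2 C) \<longleftrightarrow> ?fort 2" if "\<not> ?fort 1"
    using that edge_component_iff_fort unfolding edge_component_iff isolated by blast
  have three: "?path \<or> ?triangle \<longleftrightarrow> ?fort 3" if "\<not> ?fort 1"
    unfolding pendant_path_iff pendant_triangle_iff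
    by (rule pendant_path_or_triangle_iff_fort) (use that isolated in simp)
  have less: "(\<forall>j<1. \<not> ?fort j) \<longleftrightarrow> \<not> ?fort 0" "(\<forall>j<2. \<not> ?fort j) \<longleftrightarrow> \<not> ?fort 0 \<and> \<not> ?fort 1"
    "(\<forall>j<3. \<not> ?fort j) \<longleftrightarrow> \<not> ?fort 0 \<and> \<not> ?fort 1 \<and> \<not> ?fort 2"
    by (auto simp: numeral_eq_Suc less_Suc_eq)
  \<comment> \<open>Splits the excluded components of the third statement into the cases of sizes
    one and two.\<close>
  have component: "(\<exists>C \<in> sccs. (\<exists>v. isolated_vertex G v \<and> verts C = {v}) \<or> complete_digraph 2 C) \<longleftrightarrow>
      ?fort 1 \<or> (\<exists>C \<in> sccs. complete_digraph 2 C)"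
    using singleton_component_iff isolated by blast
  have "int (failed_power_domination_number G) = int n - 1 \<longleftrightarrow> ?fort 1"
    using fpd[of 1] fort_0 less(1) by simp
  moreover have "int (failed_power_domination_number G) = int n - 2 \<longleftrightarrow> ?fort 2 \<and> \<not> ?fort 1"
    using fpd[of 2] fort_0 less(2) by simp
  moreover have "int (failed_power_domination_number G) = int n - 3 \<longleftrightarrow>
      ?fort 3 \<and> \<not> ?fort 1 \<and> \<not> ?fort 2"
    using fpd[of 3] fort_0 less(3) by simp
  ultimately show ?thesis unfolding component isolated using edge three by argo
qed

end
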